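(* Let $D$ be a weighted oriented graph on the vertex set $\{x_1,\ldots,x_n\}$, let $I=I(D)$ and write $w_i=w(x_i)$ for all $x_i\in V(D)$. Let $C$ be a maximal strong vertex cover of $D$. Then $$I_{\subseteq C}=(L_1^D(C))+\bigl(x_i^{w_i} \mid x_i\in L_2^D(C)\bigr)+\bigl(x_ix_j^{w_j}\mid (x_i,x_j)\in E(D),\ x_i\in L_2^D(C)\cup L_3^D(C)\ \text{and}\ x_j\in L_3^D(C)\bigr).$$
   Context: A weighted oriented graph $D=(V(D),E(D),w)$ has a finite simple underlying graph $G$ (assumed connected), $V(D)=V(G)$, each edge $\{x,y\}$ of $G$ given exactly one orientation, $(x,y)\in E(D)$ meaning $x\to y$, and a weight function $w:V(D)\to\mathbb N=\{1,2,\ldots\}$. Convention: every source vertex (a vertex with no incoming edge) has weight $1$. Let $k$ be a field and $R=k[x_1,\ldots,x_n]$, vertices being identified with variables. The edge ideal is $I(D)=(x_ix_j^{w(x_j)} \mid (x_i,x_j)\in E(D))\subseteq R$. $N_D^+(x)=\{y\mid (x,y)\in E(D)\}$, $N_D^-(x)=\{y\mid (y,x)\in E(D)\}$, and $V^+(D)$ is the set of vertices with $w\neq 1$. A vertex cover of $D$ is a set $C\subseteq V(D)$ such that for each $(x,y)\in E(D)$, $x\in C$ or $y\in C$. With $C^c=V(D)\setminus C$ put $L_1^D(C)=\{x\in C\mid N_D^+(x)\cap C^c\neq\emptyset\}$, $L_2^D(C)=\{x\in C\mid x\notin L_1^D(C),\ N_D^-(x)\cap C^c\neq\emptyset\}$,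 $L_3^D(C)=C\setminus(L_1^D(C)\cup L_2^D(C))$. A vertex cover $C$ is strong if for each $x\in L_3^D(C)$ there is $(y,x)\in E(D)$ with $y\in L_2^D(C)\cup L_3^D(C)$ and $y\in V^+(D)$. A strong vertex cover is maximal if it is not contained in any other strong vertex cover of $D$. For a vertex cover $C$, $I_C:=\bigl(L_1^D(C)\cup\{x_j^{w(x_j)}\mid x_j\in L_2^D(C)\cup L_3^D(C)\}\bigr)$. It is known that the irredundant irreducible decomposition of $I(D)$ is $I(D)=\bigcap I_{C'}$ over all strong vertex covers $C'$ of $D$, with $\sqrt{I_{C'}}$ generated by the vertices of $C'$. For a strong vertex cover $C$, $I_{\subseteq C}$ denotes the intersection of all $I_{C'}$ with $C'$ a strong vertex cover of $D$ and $C'\subseteq C$. $(L_1^D(C))$ is the ideal generated by the vertices in $L_1^D(C)$. *)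

theory Defs
  imports
    "HOL-Library.Poly_Mapping"
    "HOL-Algebra.Algebraic_Closure_Type"
    "Graph_Theory.Graph_Theory"
begin

section \<open>The polynomial ring over a set of variables\<close>

text \<open>
  A monomial is a finitely supported exponent function and a polynomial a finitely supported
  function from monomials to coefficients. The type of all such polynomials has a variable for
  every element of the type \<open>'v\<close>; the carrier below selects the polynomials in which only
  variables from \<open>V\<close> occur.
\<close>

definition vertex_poly_ring :: "'v set \<Rightarrow> (('v \<Rightarrow>\<^sub>0 nat) \<Rightarrow>\<^sub>0 'k::field) ring" where
  "vertex_poly_ring V = ring_of_type_algebra
     \<lparr>carrier := {p. \<forall>m\<in>Poly_Mapping.keys p. Poly_Mapping.keys m \<subseteq> V}\<rparr>"

definition vertex_var :: "'v \<Rightarrow> ('v \<Rightarrow>\<^sub>0 nat) \<Rightarrow>\<^sub>0 'k::field" where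
  "vertex_var v = Poly_Mapping.single (Poly_Mapping.single v 1) 1"

lemma keys_times_subset:
  fixes p q :: "('v \<Rightarrow>\<^sub>0 nat) \<Rightarrow>\<^sub>0 'k::field"
  assumes "\<forall>m\<in>Poly_Mapping.keys p. Poly_Mapping.keys m \<subseteq> V" "\<forall>m\<in>Poly_Mapping.keys q. Poly_Mapping.keys m \<subseteq> V" "m \<in> Poly_Mapping.keys (p * q)"
  shows "Poly_Mapping.keys m \<subseteq> V"
proof -
  obtain a b where "m = a + b" "a \<in> Poly_Mapping.keys p" "b \<in> Poly_Mapping.keys q"
    using keys_mult[of p q] assms(3) by auto
  then show ?thesis
    using keys_add[of a b] assms(1,2) by blast
qed

lemma cring_vertex_poly_ring: "cring (vertex_poly_ring V :: (('v \<Rightarrow>\<^sub>0 nat) \<Rightarrow>\<^sub>0 'k::field) ring)"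
proof (rule cringI)
  show "abelian_group (vertex_poly_ring V :: (('v \<Rightarrow>\<^sub>0 nat) \<Rightarrow>\<^sub>0 'k) ring)"
  proof (rule abelian_groupI)
    fix x :: "('v \<Rightarrow>\<^sub>0 nat) \<Rightarrow>\<^sub>0 'k"
    assume "x \<in> carrier (vertex_poly_ring V)"
    then show "\<exists>y\<in>carrier (vertex_poly_ring V). y \<oplus>\<^bsub>vertex_poly_ring V\<^esub> x = \<zero>\<^bsub>vertex_poly_ring V\<^esub>"
      by (intro bexI[of _ "- x"]) (auto simp: vertex_poly_ring_def ring_of_type_algebra_def)
  qed (use keys_add in \<open>fastforce simp: vertex_poly_ring_def ring_of_type_algebra_def algebra_simps\<close>)+
  show "Group.comm_monoid (vertex_poly_ring V :: (('v \<Rightarrow>\<^sub>0 nat) \<Rightarrow>\<^sub>0 'k) ring)"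
    by (rule comm_monoidI)
      (auto simp: vertex_poly_ring_def ring_of_type_algebra_def algebra_simps dest: keys_times_subset)
qed (auto simp: vertex_poly_ring_def ring_of_type_algebra_def algebra_simps)

section \<open>Weighted oriented graphs\<close>

text \<open>
  The underlying graph is simple because a \<open>pair_digraph\<close> has neither loops nor parallel arcs;
  \<open>oriented\<close> says that an edge carries only one of its two orientations. \<open>connected\<close> is
  connectedness of the underlying undirected graph (strong connectedness of the symmetric closure).
  The values of \<open>w\<close> outside the vertex set are irrelevant.
\<close>

locale weighted_oriented_graph = pair_digraph D
  for D :: "'v pair_pre_digraph" and w :: "'v \<Rightarrow> nat" +
  assumes oriented: "(x, y) \<in> parcs D \<Longrightarrow> (y, x) \<notin> parcs D"
    and connected_underlying: "Digraph_Component.connected (with_proj D)"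
    and weight_pos: "x \<in> pverts D \<Longrightarrow> 1 \<le> w x"
    and weight_source: "x \<in> pverts D \<Longrightarrow> \<nexists>y. (y, x) \<in> parcs D \<Longrightarrow> w x = 1"

definition out_nbrs :: "'v pair_pre_digraph \<Rightarrow> 'v \<Rightarrow> 'v set" where
  "out_nbrs D x = {y. (x, y) \<in> parcs D}"

definition in_nbrs :: "'v pair_pre_digraph \<Rightarrow> 'v \<Rightarrow> 'v set" where
  "in_nbrs D x = {y. (y, x) \<in> parcs D}"

definition V_plus :: "'v pair_pre_digraph \<Rightarrow> ('v \<Rightarrow> nat) \<Rightarrow> 'v set" where
  "V_plus D w = {x \<in> pverts D. w x \<noteq> 1}"

definition vertex_cover :: "'v pair_pre_digraph \<Rightarrow> 'v set \<Rightarrow> bool" where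
  "vertex_cover D C \<longleftrightarrow> C \<subseteq> pverts D \<and> (\<forall>(x, y)\<in>parcs D. x \<in> C \<or> y \<in> C)"

definition L1 :: "'v pair_pre_digraph \<Rightarrow> 'v set \<Rightarrow> 'v set" where
  "L1 D C = {x \<in> C. out_nbrs D x \<inter> (pverts D - C) \<noteq> {}}"

definition L2 :: "'v pair_pre_digraph \<Rightarrow> 'v set \<Rightarrow> 'v set" where
  "L2 D C = {x \<in> C. x \<notin> L1 D C \<and> in_nbrs D x \<inter> (pverts D - C) \<noteq> {}}"

definition L3 :: "'v pair_pre_digraph \<Rightarrow> 'v set \<Rightarrow> 'v set" where
  "L3 D C = C - (L1 D C \<union> L2 D C)"

definition strong_vertex_cover ::
  "'v pair_pre_digraph \<Rightarrow> ('v \<Rightarrow> nat) \<Rightarrow> 'v set \<Rightarrow> bool" where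
  "strong_vertex_cover D w C \<longleftrightarrow> vertex_cover D C \<and>
     (\<forall>x\<in>L3 D C. \<exists>y. (y, x) \<in> parcs D \<and> y \<in> L2 D C \<union> L3 D C \<and> y \<in> V_plus D w)"

definition maximal_strong_vertex_cover ::
  "'v pair_pre_digraph \<Rightarrow> ('v \<Rightarrow> nat) \<Rightarrow> 'v set \<Rightarrow> bool" where
  "maximal_strong_vertex_cover D w C \<longleftrightarrow>
     strong_vertex_cover D w C \<and> \<not> (\<exists>C'. strong_vertex_cover D w C' \<and> C \<subset> C')"

section \<open>The ideals attached to strong vertex covers\<close>

definition cover_ideal ::
  "'v pair_pre_digraph \<Rightarrow> ('v \<Rightarrow> nat) \<Rightarrow> 'v set \<Rightarrow> (('v \<Rightarrow>\<^sub>0 nat) \<Rightarrow>\<^sub>0 'k::field) set" where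
  "cover_ideal D w C =
     Idl\<^bsub>vertex_poly_ring (pverts D)\<^esub>
       (vertex_var ` L1 D C \<union> {vertex_var x ^ w x | x. x \<in> L2 D C \<union> L3 D C})"

text \<open>
  The intersection is used for strong \<open>C\<close> only; then \<open>C\<close> itself is one of the covers \<open>C'\<close>, so the
  family is not empty.
\<close>

definition ideal_below ::
  "'v pair_pre_digraph \<Rightarrow> ('v \<Rightarrow> nat) \<Rightarrow> 'v set \<Rightarrow> (('v \<Rightarrow>\<^sub>0 nat) \<Rightarrow>\<^sub>0 'k::field) set" where
  "ideal_below D w C = \<Inter> {cover_ideal D w C' | C'. strong_vertex_cover D w C' \<and> C' \<subseteq> C}"

end

theory Submission
  imports Defs
begin

text \<open>
  Both sides of the equation are monomial ideals, so they agree as soon as they contain the same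
  monomials. A monomial \<open>a\<close> (an exponent function) lies outside the right-hand side iff it is
  \<^emph>\<open>locally standard\<close>: it is divisible by none of the listed generators, which generate what remains
  of the edge ideal when the variables outside \<open>C\<close> are set to \<open>1\<close>. It lies outside the left-hand side iff
  it lies outside the irreducible ideal of some strong cover inside \<open>C\<close>. So the theorem says that
  \<open>a\<close> is locally standard iff some strong cover \<open>C' \<subseteq> C\<close> has \<open>a\<close> outside its ideal.

  One direction (\<open>cover_standard_imp_locally_standard\<close>) reflects that the irreducible ideal of
  any cover contains the edge ideal. For the other, start from the set \<open>S\<close> of those \<open>x \<in> C\<close>
  whose exponent \<open>a x\<close> is below \<open>w x\<close>. Local standardness makes \<open>S\<close> a cover whose ideal does not
  contain \<open>a\<close>. Among the covers inside \<open>S\<close> with this property take a minimal one. If it were not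
  strong, some \<open>x\<close> in its third layer would have no heavy in-neighbour in the second or third
  layer, and deleting \<open>x\<close> would give a smaller cover with the same property, since only
  in-neighbours of \<open>x\<close>, on which \<open>a\<close> already vanishes, enter the first layer
  (\<open>minimal_cover_standard_strong\<close>). This argument replaces an appeal to the irreducible
  decomposition of the edge ideal.
\<close>

section \<open>Monomial ideals\<close>

lemma mem_carrier_vertex_poly_ring:
  "p \<in> carrier (vertex_poly_ring V) \<longleftrightarrow> (\<forall>m\<in>Poly_Mapping.keys p. Poly_Mapping.keys m \<subseteq> V)"
  by (simp add: vertex_poly_ring_def)

lemma vertex_poly_ring_ops:
  "x \<oplus>\<^bsub>vertex_poly_ring V\<^esub> y = x + y"
  "x \<otimes>\<^bsub>vertex_poly_ring V\<^esub> y = x * y"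
  "\<zero>\<^bsub>vertex_poly_ring V\<^esub> = 0"
  by (simp_all add: vertex_poly_ring_def ring_of_type_algebra_def)

lemma vertex_var_power:
  "vertex_var v ^ n = Poly_Mapping.single (Poly_Mapping.single v n) (1 :: 'k::field)"
  by (induction n) (simp_all add: vertex_var_def mult_single flip: single_add)

lemma sum_monomials:
  "(\<Sum>m\<in>Poly_Mapping.keys p. Poly_Mapping.single m (Poly_Mapping.lookup p m)) = p"
  by (rule poly_mapping_eqI) (simp add: lookup_sum lookup_single when_def in_keys_iff)

text \<open>
  The right-hand set is closed under sums and multiples, because each monomial of a sum occurs in a
  summand and each monomial of a product \<open>q * p\<close> is divisible by a monomial of \<open>p\<close>. Conversely a
  polynomial is the sum of its terms, and a term whose exponent dominates that of a generator is a
  multiple of the generator. So membership in a monomial ideal is decided monomial by monomial.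
\<close>
lemma genideal_monomials:
  fixes E :: "('v \<Rightarrow>\<^sub>0 nat) set" and V :: "'v set"
  assumes E: "\<forall>e\<in>E. Poly_Mapping.keys e \<subseteq> V"
  shows "Idl\<^bsub>vertex_poly_ring V\<^esub> ((\<lambda>e. Poly_Mapping.single e (1 :: 'k::field)) ` E) =
    {p \<in> carrier (vertex_poly_ring V). \<forall>m\<in>Poly_Mapping.keys p.
       \<exists>e\<in>E. \<forall>v. Poly_Mapping.lookup e v \<le> Poly_Mapping.lookup m v}"
    (is "Idl\<^bsub>?R\<^esub> ?G = ?J")
proof
  interpret cring ?R
    by (rule cring_vertex_poly_ring)
  have J_mult: "q * p \<in> ?J" if p: "p \<in> ?J" and q: "q \<in> carrier ?R" for p q :: "('v \<Rightarrow>\<^sub>0 nat) \<Rightarrow>\<^sub>0 'k"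
  proof -
    have "\<exists>e\<in>E. \<forall>v. Poly_Mapping.lookup e v \<le> Poly_Mapping.lookup m v"
      if m: "m \<in> Poly_Mapping.keys (q * p)" for m
    proof -
      obtain a b where "m = a + b" "b \<in> Poly_Mapping.keys p"
        using keys_mult[of q p] m by auto
      then show ?thesis
        using p by (fastforce simp: lookup_add intro: trans_le_add2)
    qed
    moreover have "q * p \<in> carrier ?R"
      using p q m_closed[of q p] by (simp add: vertex_poly_ring_ops)
    ultimately show ?thesis by simp
  qed
  have J_add: "p + q \<in> ?J" if "p \<in> ?J" "q \<in> ?J" for p q :: "('v \<Rightarrow>\<^sub>0 nat) \<Rightarrow>\<^sub>0 'k"
    using that keys_add[of p q] a_closed[of p q] by (auto simp: vertex_poly_ring_ops)
  have zero_J: "0 \<in> ?J"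
    by (simp add: mem_carrier_vertex_poly_ring)
  have J_neg: "\<ominus>\<^bsub>?R\<^esub> p \<in> ?J" if "p \<in> ?J" for p
  proof -
    have "\<ominus>\<^bsub>?R\<^esub> p = (\<ominus>\<^bsub>?R\<^esub> \<one>\<^bsub>?R\<^esub>) * p"
      using that l_minus[OF one_closed, of p] l_one[of p]
      by (metis (no_types, lifting) mem_Collect_eq vertex_poly_ring_ops(2))
    then show ?thesis
      using J_mult[OF that, of "\<ominus>\<^bsub>?R\<^esub> \<one>\<^bsub>?R\<^esub>"] by simp
  qed
  have "ideal ?J ?R"
  proof (rule idealI)
    show "subgroup ?J (add_monoid ?R)"
    proof
      show "?J \<subseteq> carrier (add_monoid ?R)"
        by auto
      show "x \<otimes>\<^bsub>add_monoid ?R\<^esub> y \<in> ?J" if "x \<in> ?J" "y \<in> ?J" for x y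
        using J_add[OF that] by (simp add: vertex_poly_ring_ops)
      show "\<one>\<^bsub>add_monoid ?R\<^esub> \<in> ?J"
        using zero_J by (simp add: vertex_poly_ring_ops)
      show "inv\<^bsub>add_monoid ?R\<^esub> x \<in> ?J" if "x \<in> ?J" for x
        using J_neg[OF that] by (simp add: a_inv_def)
    qed
    show "x \<otimes>\<^bsub>?R\<^esub> a \<in> ?J" if "a \<in> ?J" "x \<in> carrier ?R" for a x
      using J_mult[OF that] by (simp add: vertex_poly_ring_ops)
    then show "a \<otimes>\<^bsub>?R\<^esub> x \<in> ?J" if "a \<in> ?J" "x \<in> carrier ?R" for a x
      using that m_comm[of a x] by (metis (no_types, lifting) mem_Collect_eq)
  qed (rule ring_axioms)
  moreover have "?G \<subseteq> ?J"
    using E by (fastforce simp: mem_carrier_vertex_poly_ring)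
  ultimately show "Idl\<^bsub>?R\<^esub> ?G \<subseteq> ?J"
    by (rule genideal_minimal)

  have G: "?G \<subseteq> carrier ?R"
    using E by (auto simp: mem_carrier_vertex_poly_ring)
  interpret I: ideal "Idl\<^bsub>?R\<^esub> ?G" ?R
    by (rule genideal_ideal[OF G])
  show "?J \<subseteq> Idl\<^bsub>?R\<^esub> ?G"
  proof
    fix p assume p: "p \<in> ?J"
    have "Poly_Mapping.single m (Poly_Mapping.lookup p m) \<in> Idl\<^bsub>?R\<^esub> ?G"
      if m: "m \<in> Poly_Mapping.keys p" for m
    proof -
      obtain e where e: "e \<in> E" "\<forall>v. Poly_Mapping.lookup e v \<le> Poly_Mapping.lookup m v"
        using p m by blast
      have "Poly_Mapping.keys (m - e) \<subseteq> Poly_Mapping.keys m"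
        by (auto simp: in_keys_iff lookup_minus)
      then have "Poly_Mapping.keys (m - e) \<subseteq> V"
        using p m by (auto simp: mem_carrier_vertex_poly_ring)
      then have "Poly_Mapping.single (m - e) (Poly_Mapping.lookup p m) \<in> carrier ?R"
        by (simp add: mem_carrier_vertex_poly_ring)
      moreover have "Poly_Mapping.single e 1 \<in> Idl\<^bsub>?R\<^esub> ?G"
        using e(1) genideal_self[OF G] by blast
      ultimately have
        "Poly_Mapping.single (m - e) (Poly_Mapping.lookup p m) * Poly_Mapping.single e 1 \<in> Idl\<^bsub>?R\<^esub> ?G"
        using I.I_l_closed by (metis vertex_poly_ring_ops(2))
      moreover have "m - e + e = m"
        using e(2) by (intro poly_mapping_eqI) (simp add: lookup_add lookup_minus)
      ultimately show ?thesis
        by (simp add: mult_single)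
    qed
    moreover have "sum f A \<in> Idl\<^bsub>?R\<^esub> ?G"
      if "finite A" "\<And>x. x \<in> A \<Longrightarrow> f x \<in> Idl\<^bsub>?R\<^esub> ?G" for f and A :: "('v \<Rightarrow>\<^sub>0 nat) set"
      using that
      by (induction A rule: finite_induct)
        (use I.zero_closed I.a_closed in \<open>auto simp: vertex_poly_ring_ops\<close>)
    ultimately show "p \<in> Idl\<^bsub>?R\<^esub> ?G"
      using sum_monomials[of p] by (metis (no_types, lifting) finite_keys)
  qed
qed

lemma (in ring) genideal_Un:
  assumes A: "A \<subseteq> carrier R" and B: "B \<subseteq> carrier R"
  shows "Idl (A \<union> B) = Idl A <+> Idl B"
proof -
  have "Idl (A \<union> B) = Idl (Idl A \<union> Idl B)"
  proof
    have sub: "Idl A \<union> Idl B \<subseteq> carrier R"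
      using genideal_ideal[OF A] genideal_ideal[OF B] ideal.Icarr by fast
    show "Idl (A \<union> B) \<subseteq> Idl (Idl A \<union> Idl B)"
      using genideal_self[OF A] genideal_self[OF B] by (intro subset_Idl_subset[OF sub]) auto
    have "Idl A \<subseteq> Idl (A \<union> B)" "Idl B \<subseteq> Idl (A \<union> B)"
      using A B subset_Idl_subset[of "A \<union> B" A] subset_Idl_subset[of "A \<union> B" B] by simp_all
    then show "Idl (Idl A \<union> Idl B) \<subseteq> Idl (A \<union> B)"
      using A B by (intro genideal_minimal genideal_ideal) auto
  qed
  also have "\<dots> = Idl A <+> Idl B"
    using A B by (intro union_genideal genideal_ideal)
  finally show ?thesis .
qed

section \<open>Standard exponents\<close>

text \<open>
  Exponents of monomials outside the irreducible ideal of the cover \<open>C\<close>; see \<open>mem_cover_ideal_iff\<close>.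
\<close>
definition cover_standard ::
  "'v pair_pre_digraph \<Rightarrow> ('v \<Rightarrow> nat) \<Rightarrow> 'v set \<Rightarrow> ('v \<Rightarrow> nat) \<Rightarrow> bool" where
  "cover_standard D w C a \<longleftrightarrow>
     (\<forall>x\<in>L1 D C. a x = 0) \<and> (\<forall>x\<in>L2 D C \<union> L3 D C. a x < w x)"

text \<open>
  Exponents of monomials outside the sum of the three ideals in the theorem; see
  \<open>mem_local_ideal_iff\<close>.
\<close>
definition locally_standard ::
  "'v pair_pre_digraph \<Rightarrow> ('v \<Rightarrow> nat) \<Rightarrow> 'v set \<Rightarrow> ('v \<Rightarrow> nat) \<Rightarrow> bool" where
  "locally_standard D w C a \<longleftrightarrow>
     (\<forall>x\<in>L1 D C. a x = 0) \<and> (\<forall>x\<in>L2 D C. a x < w x) \<and>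
     (\<forall>x y. (x, y) \<in> parcs D \<longrightarrow> x \<in> L2 D C \<union> L3 D C \<longrightarrow> y \<in> L3 D C \<longrightarrow> a x = 0 \<or> a y < w y)"

lemmas layer_defs = L1_def L2_def L3_def out_nbrs_def in_nbrs_def

lemma layers_subset: "L1 D C \<subseteq> C" "L2 D C \<subseteq> C" "L3 D C \<subseteq> C"
  by (auto simp: layer_defs)

lemma layers_union: "L1 D C \<union> L2 D C \<union> L3 D C = C"
  by (auto simp: layer_defs)

lemma mem_cover_ideal_iff:
  assumes C: "C \<subseteq> pverts D"
  shows "p \<in> cover_ideal D w C \<longleftrightarrow> p \<in> carrier (vertex_poly_ring (pverts D)) \<and>
    (\<forall>m\<in>Poly_Mapping.keys p. \<not> cover_standard D w C (Poly_Mapping.lookup m))"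
proof -
  define E where "E = (\<lambda>x. Poly_Mapping.single x (1::nat)) ` L1 D C \<union>
    (\<lambda>x. Poly_Mapping.single x (w x)) ` (L2 D C \<union> L3 D C)"
  have gens: "vertex_var ` L1 D C \<union> {vertex_var x ^ w x | x. x \<in> L2 D C \<union> L3 D C} =
    (\<lambda>e. Poly_Mapping.single e (1 :: 'b)) ` E"
    unfolding E_def image_Un image_image Setcompr_eq_image vertex_var_power
    by (simp add: vertex_var_def)
  have V: "\<forall>e\<in>E. Poly_Mapping.keys e \<subseteq> pverts D"
    using C layers_subset[of D C] by (auto simp: E_def split: if_splits)
  have "(\<exists>e\<in>E. \<forall>v. Poly_Mapping.lookup e v \<le> a v) \<longleftrightarrow> \<not> cover_standard D w C a" for a
    unfolding E_def cover_standard_def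
    by (force simp: lookup_single when_def not_less bex_Un ball_Un)
  then show ?thesis
    unfolding cover_ideal_def gens genideal_monomials[OF V] by simp
qed

section \<open>Strong covers below a given cover\<close>

context weighted_oriented_graph
begin

text \<open>
  Contrapositively: every listed generator lies in the ideal of \<open>C'\<close>. Each of them comes from an
  arc. If one end of the arc is outside \<open>C\<close>, the other is in \<open>C'\<close>; otherwise either the head is in
  \<open>C'\<close> or the tail is in the first layer of \<open>C'\<close>.
\<close>
lemma cover_standard_imp_locally_standard:
  assumes C': "vertex_cover D C'" "C' \<subseteq> C" and a: "cover_standard D w C' a"
  shows "locally_standard D w C a"
proof -
  have bound: "a x < w x" if "x \<in> C'" for x
  proof (cases "x \<in> L1 D C'")
    case True
    then have "a x = 0" "1 \<le> w x"
      using that a C'(1) weight_pos[of x] by (auto simp: cover_standard_def vertex_cover_def)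
    then show ?thesis
      by simp
  next
    case False
    then show ?thesis
      using that a layers_union[of D C'] by (auto simp: cover_standard_def)
  qed
  \<comment> \<open>An arc whose head misses the cover puts its tail into the first layer.\<close>
  have edge: "a x = 0 \<or> y \<in> C'" if "(x, y) \<in> parcs D" for x y
    using that a C'(1) in_arcsD2[OF that]
    unfolding cover_standard_def vertex_cover_def by (fastforce simp: layer_defs)
  have cover: "x \<in> C' \<or> y \<in> C'" if "(x, y) \<in> parcs D" for x y
    using that C'(1) by (auto simp: vertex_cover_def)
  show ?thesis
    unfolding locally_standard_def
  proof (intro conjI ballI allI impI)
    fix x assume "x \<in> L1 D C"
    then obtain y where "(x, y) \<in> parcs D" "y \<notin> C"
      by (auto simp: layer_defs)
    then show "a x = 0"
      using edge C'(2) by blast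
  next
    fix x assume "x \<in> L2 D C"
    then obtain y where "(y, x) \<in> parcs D" "y \<notin> C"
      by (auto simp: layer_defs)
    then show "a x < w x"
      using cover bound C'(2) by blast
  qed (use edge bound in blast)
qed

text \<open>
  The set \<open>S\<close> is the largest candidate: a cover inside \<open>C\<close> whose ideal omits \<open>a\<close> must consist of
  vertices with \<open>a x < w x\<close>. Both conclusions hold because, for each arc, local standardness puts
  the head into \<open>S\<close> or makes \<open>a\<close> vanish at the tail, which then is in \<open>S\<close> as weights are positive.
\<close>
lemma locally_standard_imp_sublevel_cover:
  assumes C: "vertex_cover D C" and a: "locally_standard D w C a"
  defines "S \<equiv> {x \<in> C. a x < w x}"
  shows "vertex_cover D S" and "cover_standard D w S a"
proof -
  have pos: "a x < w x" if "a x = 0" "x \<in> pverts D" for x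
    using that weight_pos[of x] by simp
  have edge: "y \<in> S \<or> (x \<in> S \<and> a x = 0)" if e: "(x, y) \<in> parcs D" for x y
  proof -
    have V: "x \<in> pverts D" "y \<in> pverts D"
      using e in_arcsD1 in_arcsD2 by auto
    consider "x \<in> L1 D C" | "y \<in> L1 D C" | "y \<in> L2 D C"
      | "x \<in> L2 D C \<union> L3 D C" "y \<in> L3 D C"
    proof (cases "x \<in> C \<and> y \<in> C")
      case True
      then show ?thesis
        using that layers_union[of D C] by blast
    next
      case False
      then have "x \<in> L1 D C \<or> y \<in> L1 D C \<union> L2 D C"
        using e C V by (auto simp: vertex_cover_def layer_defs)
      then show ?thesis
        using that by blast
    qed
    then show ?thesis
      using a e V pos layers_subset[of D C] unfolding locally_standard_def S_def
      by cases blast+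
  qed
  show "vertex_cover D S"
    using edge C by (auto simp: vertex_cover_def S_def)
  show "cover_standard D w S a"
    unfolding cover_standard_def
  proof (intro conjI ballI)
    show "a x = 0" if x: "x \<in> L1 D S" for x
    proof -
      obtain y where "(x, y) \<in> parcs D" "y \<notin> S"
        using x by (auto simp: layer_defs)
      then show ?thesis
        using edge by blast
    qed
    show "a x < w x" if "x \<in> L2 D S \<union> L3 D S" for x
      using that layers_subset[of D S] by (auto simp: S_def)
  qed
qed

text \<open>
  Deleting a third-layer vertex \<open>x\<close> leaves a cover, because all neighbours of \<open>x\<close> are in the cover.
  The only vertices that change into the first layer are the in-neighbours \<open>y\<close> of \<open>x\<close>; if none of
  those outside the first layer is heavy then \<open>a y < w y = 1\<close>, so \<open>a\<close> vanishes there.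
\<close>
lemma minimal_cover_standard_strong:
  assumes C: "vertex_cover D C" and a: "cover_standard D w C a"
    and minimal: "\<And>B. vertex_cover D B \<Longrightarrow> cover_standard D w B a \<Longrightarrow> \<not> B \<subset> C"
  shows "strong_vertex_cover D w C"
proof (rule ccontr)
  assume "\<not> strong_vertex_cover D w C"
  then obtain x where x: "x \<in> L3 D C"
    and light: "\<And>y. (y, x) \<in> parcs D \<Longrightarrow> y \<in> L2 D C \<union> L3 D C \<Longrightarrow> y \<notin> V_plus D w"
    using C unfolding strong_vertex_cover_def by blast
  let ?B = "C - {x}"
  have nbrs: "y \<in> C \<and> y \<noteq> x" if "(x, y) \<in> parcs D \<or> (y, x) \<in> parcs D" for y
    using x that in_arcsD1 in_arcsD2 pair_no_loops[of "(x, y)"] oriented[of x x]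
    by (auto simp: layer_defs)
  have "vertex_cover D ?B"
    using C nbrs by (fastforce simp: vertex_cover_def)
  moreover have "cover_standard D w ?B a"
  proof -
    have zero: "a y = 0" if "(y, x) \<in> parcs D" for y
    proof (cases "y \<in> L1 D C")
      case False
      then have y: "y \<in> L2 D C \<union> L3 D C"
        using nbrs that layers_union[of D C] by blast
      then have "w y = 1"
        using light that in_arcsD1 by (auto simp: V_plus_def)
      then show ?thesis
        using a y unfolding cover_standard_def by (metis less_one)
    qed (use a in \<open>simp add: cover_standard_def\<close>)
    have "y \<in> L1 D C \<or> (y, x) \<in> parcs D" if "y \<in> L1 D ?B" for y
      using that by (auto simp: layer_defs)
    moreover have "y \<in> L2 D C \<union> L3 D C" if "y \<in> L2 D ?B \<union> L3 D ?B" for y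
      using that by (auto simp: layer_defs)
    ultimately show ?thesis
      using a zero unfolding cover_standard_def by blast
  qed
  moreover have "?B \<subset> C"
    using x layers_subset(3)[of D C] by blast
  ultimately show False
    using minimal by blast
qed

lemma locally_standard_iff:
  assumes C: "vertex_cover D C"
  shows "locally_standard D w C a \<longleftrightarrow>
    (\<exists>C'. strong_vertex_cover D w C' \<and> C' \<subseteq> C \<and> cover_standard D w C' a)"
proof
  assume a: "locally_standard D w C a"
  define S where "S = {x \<in> C. a x < w x}"
  define F where "F = {B. B \<subseteq> S \<and> vertex_cover D B \<and> cover_standard D w B a}"
  have "finite S"
    using C finite_subset[OF _ pair_finite_verts] by (auto simp: S_def vertex_cover_def)
  then have "finite F"
    by (simp add: F_def)
  moreover have "S \<in> F"
    using locally_standard_imp_sublevel_cover[OF C a] by (simp add: F_def S_def)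
  ultimately obtain B where B: "B \<in> F" and "\<forall>B'\<in>F. B' \<subseteq> B \<longrightarrow> B = B'"
    using finite_has_minimal[of F] by blast
  then have "strong_vertex_cover D w B"
    by (intro minimal_cover_standard_strong[of B a]) (auto simp: F_def)
  then show "\<exists>C'. strong_vertex_cover D w C' \<and> C' \<subseteq> C \<and> cover_standard D w C' a"
    using B by (auto simp: F_def S_def)
next
  assume "\<exists>C'. strong_vertex_cover D w C' \<and> C' \<subseteq> C \<and> cover_standard D w C' a"
  then show "locally_standard D w C a"
    using cover_standard_imp_locally_standard by (auto simp: strong_vertex_cover_def)
qed

lemma mem_ideal_below_iff:
  assumes C: "strong_vertex_cover D w C"
  shows "p \<in> ideal_below D w C \<longleftrightarrow> p \<in> carrier (vertex_poly_ring (pverts D)) \<and>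
    (\<forall>m\<in>Poly_Mapping.keys p. \<not> locally_standard D w C (Poly_Mapping.lookup m))"
proof -
  have cover: "vertex_cover D B" "B \<subseteq> pverts D" if "strong_vertex_cover D w B" for B
    using that by (auto simp: strong_vertex_cover_def vertex_cover_def)
  have "p \<in> ideal_below D w C \<longleftrightarrow>
      (\<forall>B. strong_vertex_cover D w B \<and> B \<subseteq> C \<longrightarrow> p \<in> cover_ideal D w B)"
    by (auto simp: ideal_below_def)
  then show ?thesis
    using C by (auto simp: mem_cover_ideal_iff[OF cover(2)] locally_standard_iff[OF cover(1)])
qed

text \<open>
  The third family mixes two variables; that \<open>D\<close> has no loops makes divisibility by
  \<open>x y\<^bsup>w y\<^esup>\<close> the conjunction of two conditions on separate exponents.
\<close>
lemma mem_local_ideal_iff: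
  assumes C: "C \<subseteq> pverts D"
  defines "R \<equiv> vertex_poly_ring (pverts D) :: (('v \<Rightarrow>\<^sub>0 nat) \<Rightarrow>\<^sub>0 'k::field) ring"
  shows "p \<in> Idl\<^bsub>R\<^esub> (vertex_var ` L1 D C)
      <+>\<^bsub>R\<^esub> Idl\<^bsub>R\<^esub> {vertex_var x ^ w x | x. x \<in> L2 D C}
      <+>\<^bsub>R\<^esub> Idl\<^bsub>R\<^esub> {vertex_var x * vertex_var y ^ w y | x y.
             (x, y) \<in> parcs D \<and> x \<in> L2 D C \<union> L3 D C \<and> y \<in> L3 D C} \<longleftrightarrow>
    p \<in> carrier R \<and>
    (\<forall>m\<in>Poly_Mapping.keys p. \<not> locally_standard D w C (Poly_Mapping.lookup m))"
    (is "p \<in> Idl\<^bsub>R\<^esub> ?A <+>\<^bsub>R\<^esub> Idl\<^bsub>R\<^esub> ?B <+>\<^bsub>R\<^esub> Idl\<^bsub>R\<^esub> ?G \<longleftrightarrow> _")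
proof -
  interpret R: cring R
    unfolding R_def by (rule cring_vertex_poly_ring)
  let ?mono = "\<lambda>e. Poly_Mapping.single e (1 :: 'k)"
  define arcs3 where
    "arcs3 = {(x, y). (x, y) \<in> parcs D \<and> x \<in> L2 D C \<union> L3 D C \<and> y \<in> L3 D C}"
  define EA where "EA = (\<lambda>x. Poly_Mapping.single x (1::nat)) ` L1 D C"
  define EB where "EB = (\<lambda>x. Poly_Mapping.single x (w x)) ` L2 D C"
  define EG where
    "EG = (\<lambda>(x, y). Poly_Mapping.single x 1 + Poly_Mapping.single y (w y)) ` arcs3"
  have A: "?A = ?mono ` EA"
    unfolding EA_def image_image by (simp add: vertex_var_def)
  have B: "?B = ?mono ` EB"
    unfolding EB_def image_image Setcompr_eq_image vertex_var_power by simp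
  have mult: "vertex_var x * vertex_var y ^ n =
      ?mono (Poly_Mapping.single x 1 + Poly_Mapping.single y n)" for x y :: 'v and n
    by (simp add: vertex_var_power mult_single) (simp add: vertex_var_def mult_single)
  have G: "?G = ?mono ` EG"
    unfolding EG_def arcs3_def image_image mult by (simp add: image_def) blast
  have V: "\<forall>e\<in>EA \<union> EB \<union> EG. Poly_Mapping.keys e \<subseteq> pverts D"
  proof -
    have "Poly_Mapping.keys e \<subseteq> pverts D" if "e \<in> EG" for e
    proof -
      obtain x y where xy: "(x, y) \<in> arcs3"
        and e: "e = Poly_Mapping.single x 1 + Poly_Mapping.single y (w y)"
        using \<open>e \<in> EG\<close> by (auto simp: EG_def)
      have "x \<in> C" "y \<in> C"
        using xy layers_subset[of D C] by (auto simp: arcs3_def)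
      then show ?thesis
        using C keys_add[of "Poly_Mapping.single x 1" "Poly_Mapping.single y (w y)"]
        unfolding e by (auto split: if_splits)
    qed
    moreover have "\<forall>e\<in>EA. Poly_Mapping.keys e \<subseteq> pverts D" "\<forall>e\<in>EB. Poly_Mapping.keys e \<subseteq> pverts D"
      using C layers_subset[of D C] by (auto simp: EA_def EB_def)
    ultimately show ?thesis
      by blast
  qed
  have carr: "?mono ` E \<subseteq> carrier R" if "E \<subseteq> EA \<union> EB \<union> EG" for E
    using that V by (auto simp: R_def mem_carrier_vertex_poly_ring)
  have "Idl\<^bsub>R\<^esub> ?A <+>\<^bsub>R\<^esub> Idl\<^bsub>R\<^esub> ?B <+>\<^bsub>R\<^esub> Idl\<^bsub>R\<^esub> ?G = Idl\<^bsub>R\<^esub> (?mono ` (EA \<union> EB \<union> EG))"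
    unfolding A B G image_Un
    by (subst R.genideal_Un, use carr[of EA] carr[of EB] carr[of EG] in blast,
        use carr[of EG] in blast)
      (subst R.genideal_Un, use carr[of EA] carr[of EB] in auto)
  also have "\<dots> = {p \<in> carrier R. \<forall>m\<in>Poly_Mapping.keys p.
      \<exists>e\<in>EA \<union> EB \<union> EG. \<forall>v. Poly_Mapping.lookup e v \<le> Poly_Mapping.lookup m v}"
    unfolding R_def by (rule genideal_monomials[OF V])
  finally have ideal: "Idl\<^bsub>R\<^esub> ?A <+>\<^bsub>R\<^esub> Idl\<^bsub>R\<^esub> ?B <+>\<^bsub>R\<^esub> Idl\<^bsub>R\<^esub> ?G = \<dots>" .
  have EA: "(\<exists>e\<in>EA. \<forall>v. Poly_Mapping.lookup e v \<le> a v) \<longleftrightarrow> (\<exists>x\<in>L1 D C. a x \<noteq> 0)" for a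
    by (force simp: EA_def lookup_single when_def)
  have EB: "(\<exists>e\<in>EB. \<forall>v. Poly_Mapping.lookup e v \<le> a v) \<longleftrightarrow> (\<exists>x\<in>L2 D C. \<not> a x < w x)" for a
    by (force simp: EB_def lookup_single when_def)
  have EG: "(\<exists>e\<in>EG. \<forall>v. Poly_Mapping.lookup e v \<le> a v) \<longleftrightarrow>
      (\<exists>(x, y)\<in>arcs3. a x \<noteq> 0 \<and> \<not> a y < w y)" for a
  proof -
    have "(\<forall>v. Poly_Mapping.lookup (Poly_Mapping.single x 1 + Poly_Mapping.single y (w y)) v \<le> a v)
        \<longleftrightarrow> a x \<noteq> 0 \<and> \<not> a y < w y" if "(x, y) \<in> arcs3" for x y
      using that pair_no_loops[of "(x, y)"]
      by (force simp: arcs3_def lookup_add lookup_single when_def)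
    then show ?thesis
      unfolding EG_def bex_simps by (intro bex_cong refl) (auto split: prod.split)
  qed
  have "(\<exists>e\<in>EA \<union> EB \<union> EG. \<forall>v. Poly_Mapping.lookup e v \<le> a v) \<longleftrightarrow> \<not> locally_standard D w C a" for a
    unfolding bex_Un EA EB EG by (auto simp: locally_standard_def arcs3_def)
  then show ?thesis
    unfolding ideal by simp
qed

end

theorem theorem3p5:
  fixes D :: "'v pair_pre_digraph" and w :: "'v \<Rightarrow> nat" and C :: "'v set"
    and R :: "(('v \<Rightarrow>\<^sub>0 nat) \<Rightarrow>\<^sub>0 'k::field) ring"
  assumes "weighted_oriented_graph D w"
    and "R = vertex_poly_ring (pverts D)"
    and "maximal_strong_vertex_cover D w C"
  shows "ideal_below D w C =
    Idl\<^bsub>R\<^esub> (vertex_var ` L1 D C)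
    <+>\<^bsub>R\<^esub> Idl\<^bsub>R\<^esub> {vertex_var x ^ w x | x. x \<in> L2 D C}
    <+>\<^bsub>R\<^esub> Idl\<^bsub>R\<^esub> {vertex_var x * vertex_var y ^ w y | x y.
           (x, y) \<in> parcs D \<and> x \<in> L2 D C \<union> L3 D C \<and> y \<in> L3 D C}"
proof -
  interpret weighted_oriented_graph D w
    by fact
  have C: "strong_vertex_cover D w C"
    using assms(3) by (simp add: maximal_strong_vertex_cover_def)
  then have V: "C \<subseteq> pverts D"
    by (simp add: strong_vertex_cover_def vertex_cover_def)
  show ?thesis
    unfolding assms(2) by (rule Set.set_eqI) (simp only: mem_ideal_below_iff[OF C] mem_local_ideal_iff[OF V])
qed

end
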